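(* Let $\mathsf C$ be a Markov category with conditionals. Let (A) and (B) be composable commutative squares in $\mathcal S(\mathsf C)$: (A) consists of $f_1:\Omega\to X_1$, $f_2:\Omega\to X_2$, $g_1:X_1\to Y_2$, $g_2:X_2\to Y_2$ with $g_1f_1=g_2f_2$; (B) consists of $h_1:X_1\to Y_1$, $g_1:X_1\to Y_2$, $k:Y_1\to Z$, $h_2:Y_2\to Z$ with $kh_1=h_2g_1$. If (A) and (B) are independent, then the composite square (AB), consisting of $h_1f_1:\Omega\to Y_1$, $f_2:\Omega\to X_2$, $k:Y_1\to Z$, $h_2g_2:X_2\to Z$, is independent.
   Context: A Markov category is a symmetric monoidal category $(\mathsf C,\otimes,I)$ (coherence isomorphisms suppressed) whose unit $I$ is terminal and in which every object $X$ carries a commutative comonoid structure $\mathrm{copy}_X:X\to X\otimes X$, $\mathrm{del}_X:X\to I$ compatible with the monoidal structure ($\mathrm{copy}_{X\otimes Y}$ is $\mathrm{copy}_X\otimes\mathrm{copy}_Y$ followed by the swap of the two middle factors, $\mathrm{del}_{X\otimes Y}=\mathrm{del}_X\otimes\mathrm{del}_Y$, and the structure on $I$ is trivial). The projections $\pi_X:X\otimes Y\to X$, $\pi_Y:X\otimes Y\to Y$ are obtained by deleting the other factor. For $f:A\to X$, $g:A\to Y$ write $\langle f,g\rangle=(f\otimes g)\circ\mathrm{copy}_A$ (similarly for triples, using iterated copy). A state is a morphism $p:I\to X$. $\mathsf C$ has conditionals if for every $f:A\to X\otimes Y$ there is $f|_X:X\otimes A\to Y$ with $f=(\mathrm{id}_X\otimes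 f|_X)\circ(\mathrm{copy}_X\otimes \mathrm{id}_A)\circ((\pi_X f)\otimes\mathrm{id}_A)\circ\mathrm{copy}_A$. For $f,g:X\to Y$ and a state $p:I\to X$, $f=_p g$ ($p$-almost sure equality) means $\langle \mathrm{id}_X,f\rangle\circ p=\langle\mathrm{id}_X,g\rangle\circ p$; $f$ is $p$-almost surely deterministic if $\mathrm{copy}_Y\circ f=_p(f\otimes f)\circ\mathrm{copy}_X$. The category $\mathcal P(\mathsf C)$ of probability spaces has objects $(\Omega,p)$ with $p:I\to\Omega$ a state; morphisms $(\Omega,p)\to(\Omega',q)$ are $p$-almost sure equality classes of $f:\Omega\to\Omega'$ with $f\circ p=q$; composition is that of $\mathsf C$ on representatives. The category $\mathcal S(\mathsf C)$ of sample spaces is the wide subcategory of $\mathcal P(\mathsf C)$ of classes of $p$-almost surely deterministic morphisms. A sample space is denoted by its underlying object $\Omega$, with state $p_\Omega$. A commutative square in $\mathcal S(\mathsf C)$ consisting of $f:\Omega\to X$, $g:\Omega\to Y$, $u:X\to Z$, $v:Y\to Z$ with $d:=uf=vg$ is called independent if there exist morphisms $\phi:Z\to X$ and $\psi:Z\to Y$ in $\mathsf C$ such that $\langle f,d,g\rangle\circ p_\Omega=\langle\phi,\mathrm{id}_Z,\psi\rangle\circ p_Z$ as states $I\to X\otimes Z\otimes Y$. *)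

theory Defs
  imports Main
begin

record ('o, 'm) cat =
  Obj :: "'o set"
  Arr :: "'m set"
  Dom :: "'m \<Rightarrow> 'o"
  Cod :: "'m \<Rightarrow> 'o"
  Id :: "'o \<Rightarrow> 'm"
  Comp :: "'m \<Rightarrow> 'm \<Rightarrow> 'm"  (infixr \<open>\<cdot>\<index>\<close> 70)

definition hom :: "('o, 'm, 'z) cat_scheme \<Rightarrow> 'o \<Rightarrow> 'o \<Rightarrow> 'm set" where
  "hom D A B = {f \<in> Arr D. Dom D f = A \<and> Cod D f = B}"

locale category =
  fixes D :: "('o, 'm, 'z) cat_scheme" (structure)
  assumes Dom_in_Obj: "f \<in> Arr D \<Longrightarrow> Dom D f \<in> Obj D"
    and Cod_in_Obj: "f \<in> Arr D \<Longrightarrow> Cod D f \<in> Obj D"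
    and Id_in_hom: "A \<in> Obj D \<Longrightarrow> Id D A \<in> hom D A A"
    and Comp_in_hom: "\<lbrakk>f \<in> hom D A B; g \<in> hom D B C\<rbrakk> \<Longrightarrow> g \<cdot> f \<in> hom D A C"
    and Id_left: "f \<in> hom D A B \<Longrightarrow> Id D B \<cdot> f = f"
    and Id_right: "f \<in> hom D A B \<Longrightarrow> f \<cdot> Id D A = f"
    and Comp_assoc: "\<lbrakk>f \<in> hom D A B; g \<in> hom D B C; h \<in> hom D C E\<rbrakk>
      \<Longrightarrow> (h \<cdot> g) \<cdot> f = h \<cdot> (g \<cdot> f)"

definition is_inverse :: "('o, 'm, 'z) cat_scheme \<Rightarrow> 'm \<Rightarrow> 'm \<Rightarrow> bool" where
  "is_inverse D f g \<longleftrightarrow> f \<in> Arr D \<and> g \<in> hom D (Cod D f) (Dom D f) \<and>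
     g \<cdot>\<^bsub>D\<^esub> f = Id D (Dom D f) \<and> f \<cdot>\<^bsub>D\<^esub> g = Id D (Cod D f)"

definition is_iso :: "('o, 'm, 'z) cat_scheme \<Rightarrow> 'm \<Rightarrow> bool" where
  "is_iso D f \<longleftrightarrow> (\<exists>g. is_inverse D f g)"

definition inverse_of :: "('o, 'm, 'z) cat_scheme \<Rightarrow> 'm \<Rightarrow> 'm" where
  "inverse_of D f = (THE g. is_inverse D f g)"

text \<open>The square consists of \<open>f\<close>, \<open>g\<close> out of the same object, followed by
  \<open>u\<close> and \<open>v\<close> respectively.\<close>

definition commutative_square ::
  "('o, 'm, 'z) cat_scheme \<Rightarrow> 'm \<Rightarrow> 'm \<Rightarrow> 'm \<Rightarrow> 'm \<Rightarrow> bool" where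
  "commutative_square D f g u v \<longleftrightarrow>
     {f, g, u, v} \<subseteq> Arr D \<and> Dom D f = Dom D g \<and> Cod D f = Dom D u \<and>
     Cod D g = Dom D v \<and> Cod D u = Cod D v \<and> u \<cdot>\<^bsub>D\<^esub> f = v \<cdot>\<^bsub>D\<^esub> g"

text \<open>The coherence isomorphisms are part of the data: strictness is not assumed.
  \<open>Assoc A B C\<close> goes from \<open>(A \<boxtimes> B) \<boxtimes> C\<close> to \<open>A \<boxtimes> (B \<boxtimes> C)\<close>.\<close>

record ('o, 'm) monoidal_cat = "('o, 'm) cat" +
  TensorObj :: "'o \<Rightarrow> 'o \<Rightarrow> 'o"  (infixr \<open>\<boxtimes>\<index>\<close> 75)
  TensorArr :: "'m \<Rightarrow> 'm \<Rightarrow> 'm"  (infixr \<open>\<otimes>\<index>\<close> 75)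
  Unit :: "'o"
  Assoc :: "'o \<Rightarrow> 'o \<Rightarrow> 'o \<Rightarrow> 'm"
  LUnit :: "'o \<Rightarrow> 'm"
  RUnit :: "'o \<Rightarrow> 'm"
  Swap :: "'o \<Rightarrow> 'o \<Rightarrow> 'm"

locale symmetric_monoidal_category = category C
  for C :: "('o, 'm, 'z) monoidal_cat_scheme" (structure) +
  assumes TensorObj_in_Obj: "\<lbrakk>A \<in> Obj C; B \<in> Obj C\<rbrakk> \<Longrightarrow> A \<boxtimes> B \<in> Obj C"
    and TensorArr_in_hom: "\<lbrakk>f \<in> hom C A B; g \<in> hom C A' B'\<rbrakk>
      \<Longrightarrow> f \<otimes> g \<in> hom C (A \<boxtimes> A') (B \<boxtimes> B')"
    and TensorArr_Id: "\<lbrakk>A \<in> Obj C; B \<in> Obj C\<rbrakk> \<Longrightarrow> Id C A \<otimes> Id C B = Id C (A \<boxtimes> B)"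
    and TensorArr_Comp: "\<lbrakk>f \<in> hom C A B; f' \<in> hom C B E; g \<in> hom C A' B'; g' \<in> hom C B' E'\<rbrakk>
      \<Longrightarrow> (f' \<cdot> f) \<otimes> (g' \<cdot> g) = (f' \<otimes> g') \<cdot> (f \<otimes> g)"
    and Unit_in_Obj: "Unit C \<in> Obj C"
    and Assoc_in_hom: "\<lbrakk>A \<in> Obj C; B \<in> Obj C; E \<in> Obj C\<rbrakk>
      \<Longrightarrow> Assoc C A B E \<in> hom C ((A \<boxtimes> B) \<boxtimes> E) (A \<boxtimes> (B \<boxtimes> E))"
    and Assoc_iso: "\<lbrakk>A \<in> Obj C; B \<in> Obj C; E \<in> Obj C\<rbrakk> \<Longrightarrow> is_iso C (Assoc C A B E)"
    and Assoc_natural: "\<lbrakk>f \<in> hom C A A'; g \<in> hom C B B'; h \<in> hom C E E'\<rbrakk>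
      \<Longrightarrow> Assoc C A' B' E' \<cdot> ((f \<otimes> g) \<otimes> h) = (f \<otimes> (g \<otimes> h)) \<cdot> Assoc C A B E"
    and LUnit_in_hom: "A \<in> Obj C \<Longrightarrow> LUnit C A \<in> hom C (Unit C \<boxtimes> A) A"
    and LUnit_iso: "A \<in> Obj C \<Longrightarrow> is_iso C (LUnit C A)"
    and LUnit_natural: "f \<in> hom C A B \<Longrightarrow> LUnit C B \<cdot> (Id C (Unit C) \<otimes> f) = f \<cdot> LUnit C A"
    and RUnit_in_hom: "A \<in> Obj C \<Longrightarrow> RUnit C A \<in> hom C (A \<boxtimes> Unit C) A"
    and RUnit_iso: "A \<in> Obj C \<Longrightarrow> is_iso C (RUnit C A)"
    and RUnit_natural: "f \<in> hom C A B \<Longrightarrow> RUnit C B \<cdot> (f \<otimes> Id C (Unit C)) = f \<cdot> RUnit C A"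
    and pentagon: "\<lbrakk>A \<in> Obj C; B \<in> Obj C; E \<in> Obj C; F \<in> Obj C\<rbrakk>
      \<Longrightarrow> Assoc C A B (E \<boxtimes> F) \<cdot> Assoc C (A \<boxtimes> B) E F =
          (Id C A \<otimes> Assoc C B E F) \<cdot> Assoc C A (B \<boxtimes> E) F \<cdot> (Assoc C A B E \<otimes> Id C F)"
    and triangle: "\<lbrakk>A \<in> Obj C; B \<in> Obj C\<rbrakk>
      \<Longrightarrow> (Id C A \<otimes> LUnit C B) \<cdot> Assoc C A (Unit C) B = RUnit C A \<otimes> Id C B"
    and Swap_in_hom: "\<lbrakk>A \<in> Obj C; B \<in> Obj C\<rbrakk> \<Longrightarrow> Swap C A B \<in> hom C (A \<boxtimes> B) (B \<boxtimes> A)"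
    and Swap_natural: "\<lbrakk>f \<in> hom C A A'; g \<in> hom C B B'\<rbrakk>
      \<Longrightarrow> Swap C A' B' \<cdot> (f \<otimes> g) = (g \<otimes> f) \<cdot> Swap C A B"
    and Swap_Swap: "\<lbrakk>A \<in> Obj C; B \<in> Obj C\<rbrakk> \<Longrightarrow> Swap C B A \<cdot> Swap C A B = Id C (A \<boxtimes> B)"
    and hexagon: "\<lbrakk>A \<in> Obj C; B \<in> Obj C; E \<in> Obj C\<rbrakk>
      \<Longrightarrow> Assoc C B E A \<cdot> Swap C A (B \<boxtimes> E) \<cdot> Assoc C A B E =
          (Id C B \<otimes> Swap C A E) \<cdot> Assoc C B A E \<cdot> (Swap C A B \<otimes> Id C E)"

text \<open>The isomorphism \<open>(A \<boxtimes> B) \<boxtimes> (E \<boxtimes> F) \<rightarrow> (A \<boxtimes> E) \<boxtimes> (B \<boxtimes> F)\<close>.\<close>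

definition middle_swap ::
  "('o, 'm, 'z) monoidal_cat_scheme \<Rightarrow> 'o \<Rightarrow> 'o \<Rightarrow> 'o \<Rightarrow> 'o \<Rightarrow> 'm" where
  "middle_swap C A B E F =
     inverse_of C (Assoc C A E (B \<boxtimes>\<^bsub>C\<^esub> F)) \<cdot>\<^bsub>C\<^esub>
     (Id C A \<otimes>\<^bsub>C\<^esub> (Assoc C E B F \<cdot>\<^bsub>C\<^esub> (Swap C B E \<otimes>\<^bsub>C\<^esub> Id C F) \<cdot>\<^bsub>C\<^esub> inverse_of C (Assoc C B E F))) \<cdot>\<^bsub>C\<^esub>
     Assoc C A B (E \<boxtimes>\<^bsub>C\<^esub> F)"

record ('o, 'm) markov_cat = "('o, 'm) monoidal_cat" +
  Copy :: "'o \<Rightarrow> 'm"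
  Del :: "'o \<Rightarrow> 'm"

locale markov_category = symmetric_monoidal_category C
  for C :: "('o, 'm, 'z) markov_cat_scheme" (structure) +
  assumes Unit_terminal: "A \<in> Obj C \<Longrightarrow> \<exists>!f. f \<in> hom C A (Unit C)"
    and Copy_in_hom: "A \<in> Obj C \<Longrightarrow> Copy C A \<in> hom C A (A \<boxtimes> A)"
    and Del_in_hom: "A \<in> Obj C \<Longrightarrow> Del C A \<in> hom C A (Unit C)"
    and Copy_coassoc: "A \<in> Obj C
      \<Longrightarrow> Assoc C A A A \<cdot> (Copy C A \<otimes> Id C A) \<cdot> Copy C A = (Id C A \<otimes> Copy C A) \<cdot> Copy C A"
    and Copy_counit_left: "A \<in> Obj C \<Longrightarrow> LUnit C A \<cdot> (Del C A \<otimes> Id C A) \<cdot> Copy C A = Id C A"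
    and Copy_counit_right: "A \<in> Obj C \<Longrightarrow> RUnit C A \<cdot> (Id C A \<otimes> Del C A) \<cdot> Copy C A = Id C A"
    and Copy_commute: "A \<in> Obj C \<Longrightarrow> Swap C A A \<cdot> Copy C A = Copy C A"
    and Copy_Tensor: "\<lbrakk>A \<in> Obj C; B \<in> Obj C\<rbrakk>
      \<Longrightarrow> Copy C (A \<boxtimes> B) = middle_swap C A A B B \<cdot> (Copy C A \<otimes> Copy C B)"
    and Del_Tensor: "\<lbrakk>A \<in> Obj C; B \<in> Obj C\<rbrakk>
      \<Longrightarrow> Del C (A \<boxtimes> B) = LUnit C (Unit C) \<cdot> (Del C A \<otimes> Del C B)"
    and Copy_Unit: "Copy C (Unit C) = inverse_of C (LUnit C (Unit C))"
    and Del_Unit: "Del C (Unit C) = Id C (Unit C)"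

definition proj1 :: "('o, 'm, 'z) markov_cat_scheme \<Rightarrow> 'o \<Rightarrow> 'o \<Rightarrow> 'm" where
  "proj1 C X Y = RUnit C X \<cdot>\<^bsub>C\<^esub> (Id C X \<otimes>\<^bsub>C\<^esub> Del C Y)"

definition pairing :: "('o, 'm, 'z) markov_cat_scheme \<Rightarrow> 'm \<Rightarrow> 'm \<Rightarrow> 'm" where
  "pairing C f g = (f \<otimes>\<^bsub>C\<^esub> g) \<cdot>\<^bsub>C\<^esub> Copy C (Dom C f)"

definition tripling :: "('o, 'm, 'z) markov_cat_scheme \<Rightarrow> 'm \<Rightarrow> 'm \<Rightarrow> 'm \<Rightarrow> 'm" where
  "tripling C f g h =
     (f \<otimes>\<^bsub>C\<^esub> (g \<otimes>\<^bsub>C\<^esub> h)) \<cdot>\<^bsub>C\<^esub> (Id C (Dom C f) \<otimes>\<^bsub>C\<^esub> Copy C (Dom C f)) \<cdot>\<^bsub>C\<^esub> Copy C (Dom C f)"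

definition states :: "('o, 'm, 'z) markov_cat_scheme \<Rightarrow> 'o \<Rightarrow> 'm set" where
  "states C X = hom C (Unit C) X"

definition has_conditionals :: "('o, 'm, 'z) markov_cat_scheme \<Rightarrow> bool" where
  "has_conditionals C \<longleftrightarrow>
     (\<forall>A \<in> Obj C. \<forall>X \<in> Obj C. \<forall>Y \<in> Obj C. \<forall>f \<in> hom C A (X \<boxtimes>\<^bsub>C\<^esub> Y). \<exists>c \<in> hom C (X \<boxtimes>\<^bsub>C\<^esub> A) Y.
        f = (Id C X \<otimes>\<^bsub>C\<^esub> c) \<cdot>\<^bsub>C\<^esub> Assoc C X X A \<cdot>\<^bsub>C\<^esub> (Copy C X \<otimes>\<^bsub>C\<^esub> Id C A) \<cdot>\<^bsub>C\<^esub>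
            ((proj1 C X Y \<cdot>\<^bsub>C\<^esub> f) \<otimes>\<^bsub>C\<^esub> Id C A) \<cdot>\<^bsub>C\<^esub> Copy C A)"

definition ae_eq :: "('o, 'm, 'z) markov_cat_scheme \<Rightarrow> 'm \<Rightarrow> 'm \<Rightarrow> 'm \<Rightarrow> bool" where
  "ae_eq C p f g \<longleftrightarrow>
     f \<in> Arr C \<and> g \<in> hom C (Dom C f) (Cod C f) \<and> p \<in> states C (Dom C f) \<and>
     pairing C (Id C (Dom C f)) f \<cdot>\<^bsub>C\<^esub> p = pairing C (Id C (Dom C g)) g \<cdot>\<^bsub>C\<^esub> p"

definition ae_deterministic :: "('o, 'm, 'z) markov_cat_scheme \<Rightarrow> 'm \<Rightarrow> 'm \<Rightarrow> bool" where
  "ae_deterministic C p f \<longleftrightarrow>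
     ae_eq C p (Copy C (Cod C f) \<cdot>\<^bsub>C\<^esub> f) ((f \<otimes>\<^bsub>C\<^esub> f) \<cdot>\<^bsub>C\<^esub> Copy C (Dom C f))"

definition ae_class :: "('o, 'm, 'z) markov_cat_scheme \<Rightarrow> 'm \<Rightarrow> 'm \<Rightarrow> 'm set" where
  "ae_class C p f = {g. ae_eq C p g f}"

text \<open>A morphism of probability spaces is a triple of its domain, an almost sure equality
  class, and its codomain.  The composite of two classes is the class of the composites of
  their representatives; it is written as a union of classes so that no representative has
  to be chosen.\<close>

type_synonym ('o, 'm) prob_arr = "('o \<times> 'm) \<times> 'm set \<times> ('o \<times> 'm)"

definition prob_arrs ::
  "('o, 'm, 'z) markov_cat_scheme \<Rightarrow> ('m \<Rightarrow> 'm \<Rightarrow> bool) \<Rightarrow> ('o, 'm) prob_arr set" where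
  "prob_arrs C Q = {((X, p), ae_class C p f, (Y, q)) | X p f Y q.
     X \<in> Obj C \<and> Y \<in> Obj C \<and> p \<in> states C X \<and> q \<in> states C Y \<and>
     f \<in> hom C X Y \<and> f \<cdot>\<^bsub>C\<^esub> p = q \<and> Q p f}"

definition prob_spaces ::
  "('o, 'm, 'z) markov_cat_scheme \<Rightarrow> ('o \<times> 'm, ('o, 'm) prob_arr) cat" where
  "prob_spaces C =
     \<lparr>Obj = {(X, p). X \<in> Obj C \<and> p \<in> states C X},
      Arr = prob_arrs C (\<lambda>p f. True),
      Dom = (\<lambda>(P, F, R). P),
      Cod = (\<lambda>(P, F, R). R),
      Id = (\<lambda>(X, p). ((X, p), ae_class C p (Id C X), (X, p))),
      Comp = (\<lambda>(_, G, R) (P, F, _).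
        (P, (\<Union>f \<in> F. \<Union>g \<in> G. ae_class C (snd P) (g \<cdot>\<^bsub>C\<^esub> f)), R))\<rparr>"

definition sample_spaces ::
  "('o, 'm, 'z) markov_cat_scheme \<Rightarrow> ('o \<times> 'm, ('o, 'm) prob_arr) cat" where
  "sample_spaces C = (prob_spaces C)\<lparr>Arr := prob_arrs C (ae_deterministic C)\<rparr>"

definition reps :: "('o, 'm) prob_arr \<Rightarrow> 'm set" where
  "reps F = fst (snd F)"

text \<open>The state \<open>\<langle>f, d, g\<rangle> \<circ> p\<close> does not depend on the representatives of \<open>f\<close>, \<open>d\<close>, \<open>g\<close>,
  and classes of morphisms are nonempty, so quantifying universally over representatives is
  the same as choosing some.\<close>

definition independent_square ::
  "('o, 'm, 'z) markov_cat_scheme \<Rightarrow> ('o, 'm) prob_arr \<Rightarrow> ('o, 'm) prob_arr \<Rightarrow>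
    ('o, 'm) prob_arr \<Rightarrow> ('o, 'm) prob_arr \<Rightarrow> bool" where
  "independent_square C f g u v \<longleftrightarrow>
     commutative_square (sample_spaces C) f g u v \<and>
     (let (\<Omega>, p\<^sub>\<Omega>) = Dom (sample_spaces C) f;
          (X, p\<^sub>X) = Cod (sample_spaces C) f;
          (Y, p\<^sub>Y) = Cod (sample_spaces C) g;
          (Z, p\<^sub>Z) = Cod (sample_spaces C) u;
          d = u \<cdot>\<^bsub>sample_spaces C\<^esub> f
      in \<exists>\<phi> \<in> hom C Z X. \<exists>\<psi> \<in> hom C Z Y.
           \<forall>f' \<in> reps f. \<forall>d' \<in> reps d. \<forall>g' \<in> reps g.
             tripling C f' d' g' \<cdot>\<^bsub>C\<^esub> p\<^sub>\<Omega> = tripling C \<phi> (Id C Z) \<psi> \<cdot>\<^bsub>C\<^esub> p\<^sub>Z)"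

end

theory Submission
  imports Defs
begin

text \<open>Independence of a square with diagonal \<open>d\<close> says that its two legs become conditionally
  independent given \<open>d\<close>, with conditional distributions \<open>\<phi>\<close> and \<open>\<psi>\<close>.  Let \<open>\<phi>\<close>, \<open>\<psi>\<close> witness (A) and
  \<open>\<phi>'\<close>, \<open>\<psi>'\<close> witness (B).  The pasted square is witnessed by \<open>\<phi>'\<close> and \<open>\<psi> \<circ> \<psi>'\<close>.

  The point is that \<open>\<psi> \<circ> g\<^sub>1\<close> is a conditional distribution of \<open>f\<^sub>2\<close> given \<open>f\<^sub>1\<close>: by almost sure
  determinism of \<open>f\<^sub>1\<close>, the joint state \<open>\<langle>id, g\<^sub>1\<rangle> \<circ> f\<^sub>1 \<circ> p\<close> is \<open>\<langle>f\<^sub>1, g\<^sub>1 f\<^sub>1\<rangle> \<circ> p\<close>, which by (A) is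
  \<open>\<langle>\<phi>, id\<rangle> \<circ> q\<close>; applying \<open>\<psi>\<close> to the second factor gives \<open>\<langle>\<phi>, \<psi>\<rangle> \<circ> q\<close>, which by (A) again is
  \<open>\<langle>f\<^sub>1, f\<^sub>2\<rangle> \<circ> p\<close>.  Apply \<open>\<psi>\<close> to the last factor of the equation for (B).  One side becomes
  \<open>\<langle>\<phi>', id, \<psi> \<psi>'\<rangle>\<close> after the state of \<open>Z\<close>.  On the other side \<open>h\<^sub>1\<close> and \<open>k h\<^sub>1\<close> are applied to the first
  factor of \<open>\<langle>id, \<psi> g\<^sub>1\<rangle> \<circ> f\<^sub>1 \<circ> p = \<langle>f\<^sub>1, f\<^sub>2\<rangle> \<circ> p\<close>, and since \<open>f\<^sub>1\<close> is almost surely deterministic it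
  can be moved through the copy: the result is \<open>\<langle>h\<^sub>1 f\<^sub>1, k h\<^sub>1 f\<^sub>1, f\<^sub>2\<rangle> \<circ> p\<close>.  This is
  \<open>independence_paste\<close>.

  The rest makes this argument meaningful for almost sure equality classes.  Conditionals
  provide Bayesian inverses (\<open>bayesian_inverse_exists\<close>), hence almost sure equality with respect to
  \<open>f \<circ> p\<close> is preserved by precomposition with \<open>f\<close> (\<open>ae_eq_precomp\<close>).  It follows that composites of
  classes are represented by composites of representatives and stay almost surely deterministic,
  so that independence can be tested on representatives (\<open>independent_square_iff_rep\<close>).

  All coherence bookkeeping is confined to a few equations for pairings, which say how tensor
  products, associators, symmetries and projections act on \<open>\<langle>f, g\<rangle>\<close>.\<close>

section \<open>Calculus of pairings\<close>

context category
begin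

text \<open>Typing is rephrased with \<open>Arr\<close>, \<open>Dom\<close> and \<open>Cod\<close>: membership in a hom-set of a composite
  leaves the middle object undetermined, whereas these equations are solved by rewriting.\<close>

lemma arr_simps [simp]:
  "f \<in> Arr D \<Longrightarrow> Dom D f \<in> Obj D"
  "f \<in> Arr D \<Longrightarrow> Cod D f \<in> Obj D"
  "A \<in> Obj D \<Longrightarrow> Id D A \<in> Arr D"
  "A \<in> Obj D \<Longrightarrow> Dom D (Id D A) = A"
  "A \<in> Obj D \<Longrightarrow> Cod D (Id D A) = A"
  using Dom_in_Obj Cod_in_Obj Id_in_hom by (auto simp: hom_def)

lemma comp_simps [simp]:
  assumes "f \<in> Arr D" "g \<in> Arr D" "Dom D g = Cod D f"
  shows "g \<cdot> f \<in> Arr D" "Dom D (g \<cdot> f) = Dom D f" "Cod D (g \<cdot> f) = Cod D g"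
  using Comp_in_hom[of f "Dom D f" "Cod D f" g "Cod D g"] assms by (auto simp: hom_def)

lemma id_simps [simp]:
  "f \<in> Arr D \<Longrightarrow> Cod D f = B \<Longrightarrow> Id D B \<cdot> f = f"
  "f \<in> Arr D \<Longrightarrow> Dom D f = A \<Longrightarrow> f \<cdot> Id D A = f"
  by (rule Id_left, simp add: hom_def) (rule Id_right, simp add: hom_def)

lemma comp_assoc:
  assumes "f \<in> Arr D" "g \<in> Arr D" "h \<in> Arr D" "Dom D g = Cod D f" "Dom D h = Cod D g"
  shows "(h \<cdot> g) \<cdot> f = h \<cdot> g \<cdot> f"
  using assms by (intro Comp_assoc) (auto simp: hom_def)

end

context symmetric_monoidal_category
begin

lemma tensor_simps [simp]:
  assumes "f \<in> Arr C" "g \<in> Arr C"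
  shows "f \<otimes> g \<in> Arr C" "Dom C (f \<otimes> g) = Dom C f \<boxtimes> Dom C g"
    "Cod C (f \<otimes> g) = Cod C f \<boxtimes> Cod C g"
  using TensorArr_in_hom[of f "Dom C f" "Cod C f" g "Dom C g" "Cod C g"] assms
  by (auto simp: hom_def)

lemma structure_simps [simp]:
  "Unit C \<in> Obj C"
  "A \<in> Obj C \<Longrightarrow> B \<in> Obj C \<Longrightarrow> A \<boxtimes> B \<in> Obj C"
  "A \<in> Obj C \<Longrightarrow> B \<in> Obj C \<Longrightarrow> E \<in> Obj C \<Longrightarrow> Assoc C A B E \<in> Arr C"
  "A \<in> Obj C \<Longrightarrow> B \<in> Obj C \<Longrightarrow> E \<in> Obj C \<Longrightarrow> Dom C (Assoc C A B E) = (A \<boxtimes> B) \<boxtimes> E"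
  "A \<in> Obj C \<Longrightarrow> B \<in> Obj C \<Longrightarrow> E \<in> Obj C \<Longrightarrow> Cod C (Assoc C A B E) = A \<boxtimes> B \<boxtimes> E"
  "A \<in> Obj C \<Longrightarrow> LUnit C A \<in> Arr C"
  "A \<in> Obj C \<Longrightarrow> Dom C (LUnit C A) = Unit C \<boxtimes> A"
  "A \<in> Obj C \<Longrightarrow> Cod C (LUnit C A) = A"
  "A \<in> Obj C \<Longrightarrow> RUnit C A \<in> Arr C"
  "A \<in> Obj C \<Longrightarrow> Dom C (RUnit C A) = A \<boxtimes> Unit C"
  "A \<in> Obj C \<Longrightarrow> Cod C (RUnit C A) = A"
  "A \<in> Obj C \<Longrightarrow> B \<in> Obj C \<Longrightarrow> Swap C A B \<in> Arr C"
  "A \<in> Obj C \<Longrightarrow> B \<in> Obj C \<Longrightarrow> Dom C (Swap C A B) = A \<boxtimes> B"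
  "A \<in> Obj C \<Longrightarrow> B \<in> Obj C \<Longrightarrow> Cod C (Swap C A B) = B \<boxtimes> A"
  using Assoc_in_hom[of A B E] LUnit_in_hom[of A] RUnit_in_hom[of A] Swap_in_hom[of A B]
  by (simp_all add: hom_def Unit_in_Obj TensorObj_in_Obj)

lemma tensor_comp:
  assumes "f \<in> Arr C" "f' \<in> Arr C" "g \<in> Arr C" "g' \<in> Arr C"
    "Dom C f' = Cod C f" "Dom C g' = Cod C g"
  shows "(f' \<otimes> g') \<cdot> (f \<otimes> g) = (f' \<cdot> f) \<otimes> (g' \<cdot> g)"
  using assms by (intro TensorArr_Comp[symmetric]) (auto simp: hom_def)

end

context markov_category
begin

abbreviation pair :: "'m \<Rightarrow> 'm \<Rightarrow> 'm"  (\<open>\<langle>_,/ _\<rangle>\<close>) where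
  "\<langle>f, g\<rangle> \<equiv> pairing C f g"

lemma comonoid_simps [simp]:
  "A \<in> Obj C \<Longrightarrow> Copy C A \<in> Arr C"
  "A \<in> Obj C \<Longrightarrow> Dom C (Copy C A) = A"
  "A \<in> Obj C \<Longrightarrow> Cod C (Copy C A) = A \<boxtimes> A"
  "A \<in> Obj C \<Longrightarrow> Del C A \<in> Arr C"
  "A \<in> Obj C \<Longrightarrow> Dom C (Del C A) = A"
  "A \<in> Obj C \<Longrightarrow> Cod C (Del C A) = Unit C"
  using Copy_in_hom Del_in_hom by (auto simp: hom_def)

lemma del_comp:
  assumes "f \<in> Arr C" "Cod C f = B"
  shows "Del C B \<cdot> f = Del C (Dom C f)"
proof -
  have "Del C B \<cdot> f \<in> hom C (Dom C f) (Unit C)" "Del C (Dom C f) \<in> hom C (Dom C f) (Unit C)"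
    using assms by (auto simp: hom_def)
  then show ?thesis
    using Unit_terminal[of "Dom C f"] assms(1) by auto
qed

lemma pairing_simps [simp]:
  assumes "f \<in> Arr C" "g \<in> Arr C" "Dom C g = Dom C f"
  shows "\<langle>f, g\<rangle> \<in> Arr C" "Dom C \<langle>f, g\<rangle> = Dom C f" "Cod C \<langle>f, g\<rangle> = Cod C f \<boxtimes> Cod C g"
  using assms by (simp_all add: pairing_def)

text \<open>Most proofs below associate composites to the left: in \<open>((a \<otimes> b) \<circ> \<langle>f, g\<rangle>) \<circ> p\<close> the left side of
  this rule is then a subterm, and likewise for associator, symmetry and projections.\<close>

lemma tensor_pairing:
  assumes "f \<in> Arr C" "g \<in> Arr C" "Dom C g = Dom C f" "a \<in> Arr C" "b \<in> Arr C"
    "Dom C a = Cod C f" "Dom C b = Cod C g"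
  shows "(a \<otimes> b) \<cdot> \<langle>f, g\<rangle> = \<langle>a \<cdot> f, b \<cdot> g\<rangle>"
  using assms by (simp add: pairing_def comp_assoc[symmetric] tensor_comp)

lemma pairing_id_id: "A \<in> Obj C \<Longrightarrow> \<langle>Id C A, Id C A\<rangle> = Copy C A"
  by (simp add: pairing_def TensorArr_Id)

text \<open>Coassociativity of copying, transported along naturality of the associator.\<close>

lemma assoc_pairing:
  assumes "f \<in> Arr C" "g \<in> Arr C" "h \<in> Arr C" "Dom C g = Dom C f" "Dom C h = Dom C f"
  shows "Assoc C (Cod C f) (Cod C g) (Cod C h) \<cdot> \<langle>\<langle>f, g\<rangle>, h\<rangle> = \<langle>f, \<langle>g, h\<rangle>\<rangle>"
proof -
  let ?A = "Dom C f"
  have nat: "Assoc C (Cod C f) (Cod C g) (Cod C h) \<cdot> ((f \<otimes> g) \<otimes> h) = (f \<otimes> (g \<otimes> h)) \<cdot> Assoc C ?A ?A ?A"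
    using assms by (intro Assoc_natural) (auto simp: hom_def)
  have l: "\<langle>\<langle>f, g\<rangle>, h\<rangle> = ((f \<otimes> g) \<otimes> h) \<cdot> (Copy C ?A \<otimes> Id C ?A) \<cdot> Copy C ?A"
    using assms by (simp add: pairing_def comp_assoc[symmetric] tensor_comp)
  have r: "\<langle>f, \<langle>g, h\<rangle>\<rangle> = (f \<otimes> (g \<otimes> h)) \<cdot> (Id C ?A \<otimes> Copy C ?A) \<cdot> Copy C ?A"
    using assms by (simp add: pairing_def comp_assoc[symmetric] tensor_comp)
  have "Assoc C (Cod C f) (Cod C g) (Cod C h) \<cdot> \<langle>\<langle>f, g\<rangle>, h\<rangle> =
      (Assoc C (Cod C f) (Cod C g) (Cod C h) \<cdot> ((f \<otimes> g) \<otimes> h)) \<cdot> (Copy C ?A \<otimes> Id C ?A) \<cdot> Copy C ?A"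
    unfolding l using assms by (simp add: comp_assoc)
  also have "\<dots> = (f \<otimes> (g \<otimes> h)) \<cdot> Assoc C ?A ?A ?A \<cdot> (Copy C ?A \<otimes> Id C ?A) \<cdot> Copy C ?A"
    unfolding nat using assms by (simp add: comp_assoc)
  also have "\<dots> = \<langle>f, \<langle>g, h\<rangle>\<rangle>"
    unfolding r using assms by (simp add: Copy_coassoc)
  finally show ?thesis .
qed

text \<open>Commutativity of copying, transported along naturality of the symmetry.\<close>

lemma swap_pairing:
  assumes "f \<in> Arr C" "g \<in> Arr C" "Dom C g = Dom C f"
  shows "Swap C (Cod C f) (Cod C g) \<cdot> \<langle>f, g\<rangle> = \<langle>g, f\<rangle>"
proof -
  let ?A = "Dom C f"
  have nat: "Swap C (Cod C f) (Cod C g) \<cdot> (f \<otimes> g) = (g \<otimes> f) \<cdot> Swap C ?A ?A"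
    using assms by (intro Swap_natural) (auto simp: hom_def)
  have "Swap C (Cod C f) (Cod C g) \<cdot> \<langle>f, g\<rangle> = (Swap C (Cod C f) (Cod C g) \<cdot> (f \<otimes> g)) \<cdot> Copy C ?A"
    using assms by (simp add: pairing_def comp_assoc)
  also have "\<dots> = (g \<otimes> f) \<cdot> Swap C ?A ?A \<cdot> Copy C ?A"
    unfolding nat using assms by (simp add: comp_assoc)
  also have "\<dots> = \<langle>g, f\<rangle>"
    using assms by (simp add: Copy_commute pairing_def)
  finally show ?thesis .
qed

definition proj2 :: "'o \<Rightarrow> 'o \<Rightarrow> 'm" where
  "proj2 X Y = LUnit C Y \<cdot> (Del C X \<otimes> Id C Y)"

lemma proj_simps [simp]:
  assumes "X \<in> Obj C" "Y \<in> Obj C"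
  shows "proj1 C X Y \<in> Arr C" "Dom C (proj1 C X Y) = X \<boxtimes> Y" "Cod C (proj1 C X Y) = X"
    "proj2 X Y \<in> Arr C" "Dom C (proj2 X Y) = X \<boxtimes> Y" "Cod C (proj2 X Y) = Y"
  using assms by (simp_all add: proj1_def proj2_def)

text \<open>Counitality of copying, transported along naturality of the unitors; this is what makes
  \<open>f\<close> and \<open>g\<close> the marginals of \<open>\<langle>f, g\<rangle>\<close>.\<close>

lemma runit_pairing_del:
  assumes "f \<in> Arr C"
  shows "RUnit C (Cod C f) \<cdot> \<langle>f, Del C (Dom C f)\<rangle> = f"
proof -
  let ?A = "Dom C f"
  have nat: "RUnit C (Cod C f) \<cdot> (f \<otimes> Id C (Unit C)) = f \<cdot> RUnit C ?A"
    using assms by (intro RUnit_natural) (auto simp: hom_def)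
  have "\<langle>f, Del C ?A\<rangle> = (f \<otimes> Id C (Unit C)) \<cdot> (Id C ?A \<otimes> Del C ?A) \<cdot> Copy C ?A"
    using assms by (simp add: pairing_def comp_assoc[symmetric] tensor_comp)
  then have "RUnit C (Cod C f) \<cdot> \<langle>f, Del C ?A\<rangle> =
      (RUnit C (Cod C f) \<cdot> (f \<otimes> Id C (Unit C))) \<cdot> (Id C ?A \<otimes> Del C ?A) \<cdot> Copy C ?A"
    using assms by (simp add: comp_assoc)
  also have "\<dots> = f \<cdot> RUnit C ?A \<cdot> (Id C ?A \<otimes> Del C ?A) \<cdot> Copy C ?A"
    unfolding nat using assms by (simp add: comp_assoc)
  finally show ?thesis
    using assms by (simp add: Copy_counit_right)
qed

lemma lunit_pairing_del:
  assumes "f \<in> Arr C"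
  shows "LUnit C (Cod C f) \<cdot> \<langle>Del C (Dom C f), f\<rangle> = f"
proof -
  let ?A = "Dom C f"
  have nat: "LUnit C (Cod C f) \<cdot> (Id C (Unit C) \<otimes> f) = f \<cdot> LUnit C ?A"
    using assms by (intro LUnit_natural) (auto simp: hom_def)
  have "\<langle>Del C ?A, f\<rangle> = (Id C (Unit C) \<otimes> f) \<cdot> (Del C ?A \<otimes> Id C ?A) \<cdot> Copy C ?A"
    using assms by (simp add: pairing_def comp_assoc[symmetric] tensor_comp)
  then have "LUnit C (Cod C f) \<cdot> \<langle>Del C ?A, f\<rangle> =
      (LUnit C (Cod C f) \<cdot> (Id C (Unit C) \<otimes> f)) \<cdot> (Del C ?A \<otimes> Id C ?A) \<cdot> Copy C ?A"
    using assms by (simp add: comp_assoc)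
  also have "\<dots> = f \<cdot> LUnit C ?A \<cdot> (Del C ?A \<otimes> Id C ?A) \<cdot> Copy C ?A"
    unfolding nat using assms by (simp add: comp_assoc)
  finally show ?thesis
    using assms by (simp add: Copy_counit_left)
qed

lemma proj1_pairing:
  assumes "f \<in> Arr C" "g \<in> Arr C" "Dom C g = Dom C f"
  shows "proj1 C (Cod C f) (Cod C g) \<cdot> \<langle>f, g\<rangle> = f"
  using assms
  by (simp add: proj1_def comp_assoc tensor_pairing del_comp runit_pairing_del)

lemma proj2_pairing:
  assumes "f \<in> Arr C" "g \<in> Arr C" "Dom C g = Dom C f"
  shows "proj2 (Cod C f) (Cod C g) \<cdot> \<langle>f, g\<rangle> = g"
proof -
  have "proj2 (Cod C f) (Cod C g) \<cdot> \<langle>f, g\<rangle> = LUnit C (Cod C g) \<cdot> \<langle>Del C (Dom C g), g\<rangle>"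
    using assms by (simp add: proj2_def comp_assoc tensor_pairing del_comp)
  then show ?thesis
    using assms lunit_pairing_del[of g] by simp
qed

lemma tripling_eq_pairing:
  assumes "f \<in> Arr C" "g \<in> Arr C" "h \<in> Arr C" "Dom C g = Dom C f" "Dom C h = Dom C f"
  shows "tripling C f g h = \<langle>f, \<langle>g, h\<rangle>\<rangle>"
  using assms
  by (simp add: tripling_def pairing_def comp_assoc[symmetric] tensor_comp)

lemma runit_monic:
  assumes "X \<in> Obj C" "a \<in> Arr C" "b \<in> Arr C" "Cod C a = X \<boxtimes> Unit C" "Cod C b = X \<boxtimes> Unit C"
    "RUnit C X \<cdot> a = RUnit C X \<cdot> b"
  shows "a = b"
proof -
  obtain r where "is_inverse C (RUnit C X) r"
    using RUnit_iso assms(1) unfolding is_iso_def by blast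
  then have r: "r \<in> Arr C" "Dom C r = X" "r \<cdot> RUnit C X = Id C (X \<boxtimes> Unit C)"
    using assms(1) by (auto simp: is_inverse_def hom_def)
  have "(r \<cdot> RUnit C X) \<cdot> a = (r \<cdot> RUnit C X) \<cdot> b"
    using r(1,2) assms by (simp add: comp_assoc)
  then show ?thesis
    unfolding r(3) using assms by simp
qed

section \<open>Almost sure equality\<close>

lemma ae_eq_iff:
  "ae_eq C p f g \<longleftrightarrow> f \<in> Arr C \<and> g \<in> Arr C \<and> p \<in> Arr C \<and> Dom C g = Dom C f \<and> Cod C g = Cod C f \<and>
     Dom C p = Unit C \<and> Cod C p = Dom C f \<and>
     \<langle>Id C (Dom C f), f\<rangle> \<cdot> p = \<langle>Id C (Dom C f), g\<rangle> \<cdot> p"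
  unfolding ae_eq_def states_def hom_def by auto

lemma ae_eqD:
  assumes "ae_eq C p f g"
  shows "f \<in> Arr C" "g \<in> Arr C" "p \<in> Arr C" "Dom C g = Dom C f" "Cod C g = Cod C f"
     "Dom C p = Unit C" "Cod C p = Dom C f"
  using assms by (simp_all add: ae_eq_iff)

text \<open>The identity in the definition of almost sure equality may be replaced by any map \<open>u\<close>,
  because \<open>\<langle>u, h\<rangle> = (u \<otimes> id) \<circ> \<langle>id, h\<rangle>\<close>.\<close>

lemma ae_eq_pairing_right:
  assumes "ae_eq C p f g" "u \<in> Arr C" "Dom C u = Dom C f"
  shows "\<langle>u, f\<rangle> \<cdot> p = \<langle>u, g\<rangle> \<cdot> p"
proof -
  note ae = ae_eqD[OF assms(1)]
  have fact: "\<langle>u, h\<rangle> \<cdot> p = (u \<otimes> Id C (Cod C f)) \<cdot> \<langle>Id C (Dom C f), h\<rangle> \<cdot> p"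
    if "h \<in> Arr C" "Dom C h = Dom C f" "Cod C h = Cod C f" for h
    using that assms(2,3) ae by (simp add: comp_assoc[symmetric] tensor_pairing)
  have "\<langle>Id C (Dom C f), f\<rangle> \<cdot> p = \<langle>Id C (Dom C f), g\<rangle> \<cdot> p"
    using assms(1) by (simp add: ae_eq_iff)
  then show ?thesis
    using ae by (simp add: fact)
qed

lemma ae_eq_pairing_left:
  assumes "ae_eq C p f g" "u \<in> Arr C" "Dom C u = Dom C f"
  shows "\<langle>f, u\<rangle> \<cdot> p = \<langle>g, u\<rangle> \<cdot> p"
proof -
  note ae = ae_eqD[OF assms(1)]
  have fact: "\<langle>h, u\<rangle> \<cdot> p = Swap C (Cod C u) (Cod C f) \<cdot> \<langle>u, h\<rangle> \<cdot> p"
    if "h \<in> Arr C" "Dom C h = Dom C f" "Cod C h = Cod C f" for h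
    using that assms(2,3) ae swap_pairing[of u h] by (simp add: comp_assoc[symmetric])
  show ?thesis
    using ae ae_eq_pairing_right[OF assms] by (simp add: fact)
qed

lemma ae_eq_comp_state:
  assumes "ae_eq C p f g"
  shows "f \<cdot> p = g \<cdot> p"
proof -
  note ae = ae_eqD[OF assms]
  have "proj1 C (Cod C f) (Dom C f) \<cdot> \<langle>f, Id C (Dom C f)\<rangle> \<cdot> p =
        proj1 C (Cod C f) (Dom C f) \<cdot> \<langle>g, Id C (Dom C f)\<rangle> \<cdot> p"
    using ae_eq_pairing_left[OF assms, of "Id C (Dom C f)"] ae by simp
  then show ?thesis
    using ae proj1_pairing[of f "Id C (Dom C f)"] proj1_pairing[of g "Id C (Dom C f)"]
    by (simp add: comp_assoc[symmetric])
qed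

lemma ae_eq_refl:
  "f \<in> Arr C \<Longrightarrow> p \<in> Arr C \<Longrightarrow> Dom C p = Unit C \<Longrightarrow> Cod C p = Dom C f \<Longrightarrow> ae_eq C p f f"
  by (simp add: ae_eq_iff)

lemma ae_eq_sym: "ae_eq C p f g \<Longrightarrow> ae_eq C p g f"
  by (simp add: ae_eq_iff)

lemma ae_eq_trans: "ae_eq C p f g \<Longrightarrow> ae_eq C p g h \<Longrightarrow> ae_eq C p f h"
  by (simp add: ae_eq_iff)

lemma ae_eq_postcomp:
  assumes "ae_eq C p f g" "a \<in> Arr C" "Dom C a = Cod C f"
  shows "ae_eq C p (a \<cdot> f) (a \<cdot> g)"
proof -
  note ae = ae_eqD[OF assms(1)]
  have fact: "\<langle>Id C (Dom C f), a \<cdot> h\<rangle> \<cdot> p =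
      (Id C (Dom C f) \<otimes> a) \<cdot> \<langle>Id C (Dom C f), h\<rangle> \<cdot> p"
    if "h \<in> Arr C" "Dom C h = Dom C f" "Cod C h = Cod C f" for h
    using that assms(2,3) ae by (simp add: comp_assoc[symmetric] tensor_pairing)
  have "\<langle>Id C (Dom C f), f\<rangle> \<cdot> p = \<langle>Id C (Dom C f), g\<rangle> \<cdot> p"
    using assms(1) by (simp add: ae_eq_iff)
  then show ?thesis
    using ae assms(2,3) by (simp add: ae_eq_iff fact)
qed

text \<open>Reassociating \<open>\<langle>id, \<langle>f, h\<rangle>\<rangle>\<close> as \<open>\<langle>\<langle>id, f\<rangle>, h\<rangle>\<close> exhibits \<open>h\<close> as one component of a pairing, so it
  may be changed almost surely; the first component follows by symmetry.\<close>

lemma ae_eq_pairing: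
  assumes f: "ae_eq C p f f'" and g: "ae_eq C p g g'"
  shows "ae_eq C p \<langle>f, g\<rangle> \<langle>f', g'\<rangle>"
proof -
  note ae = ae_eqD[OF f] ae_eqD[OF g]
  have right: "ae_eq C p \<langle>f, g\<rangle> \<langle>f, g'\<rangle>" if "ae_eq C p g g'" "f \<in> Arr C" "Dom C f = Dom C g" for f g g'
  proof -
    note ae' = ae_eqD[OF that(1)]
    let ?I = "Id C (Dom C g)"
    have fact: "\<langle>?I, \<langle>f, h\<rangle>\<rangle> \<cdot> p = Assoc C (Dom C g) (Cod C f) (Cod C g) \<cdot> \<langle>\<langle>?I, f\<rangle>, h\<rangle> \<cdot> p"
      if "h \<in> Arr C" "Dom C h = Dom C g" "Cod C h = Cod C g" for h
      using that \<open>f \<in> Arr C\<close> \<open>Dom C f = Dom C g\<close> ae' assoc_pairing[of ?I f h]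
      by (simp add: comp_assoc[symmetric])
    have "\<langle>\<langle>?I, f\<rangle>, g\<rangle> \<cdot> p = \<langle>\<langle>?I, f\<rangle>, g'\<rangle> \<cdot> p"
      using that ae' by (intro ae_eq_pairing_right) simp_all
    then show ?thesis
      using that ae' by (simp add: ae_eq_iff fact)
  qed
  have "ae_eq C p \<langle>f, g\<rangle> (Swap C (Cod C g) (Cod C f) \<cdot> \<langle>g, f'\<rangle>)"
    using ae_eq_postcomp[OF right[OF f, of g], of "Swap C (Cod C g) (Cod C f)"] ae
      swap_pairing[of g f] by simp
  then have "ae_eq C p \<langle>f, g\<rangle> \<langle>f', g\<rangle>"
    using ae swap_pairing[of g f'] by simp
  then show ?thesis
    using right[OF g, of f'] ae by (auto intro: ae_eq_trans)
qed

text \<open>The form in which determinism is used: \<open>f\<close> distributes over pairings, since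
  \<open>\<langle>u, v\<rangle> = (u \<otimes> v) \<circ> copy\<close>.\<close>

lemma ae_deterministic_pairing:
  assumes "ae_deterministic C p f" "f \<in> Arr C" "u \<in> Arr C" "v \<in> Arr C" "Dom C u = Cod C f" "Dom C v = Cod C f"
  shows "ae_eq C p (\<langle>u, v\<rangle> \<cdot> f) \<langle>u \<cdot> f, v \<cdot> f\<rangle>"
proof -
  have "ae_eq C p ((u \<otimes> v) \<cdot> Copy C (Cod C f) \<cdot> f) ((u \<otimes> v) \<cdot> (f \<otimes> f) \<cdot> Copy C (Dom C f))"
    using assms by (intro ae_eq_postcomp) (simp_all add: ae_deterministic_def)
  then show ?thesis
    using assms by (simp add: pairing_def comp_assoc[symmetric] tensor_comp)
qed

section \<open>Conditionals and composition of classes\<close>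

text \<open>The Bayesian inverse of \<open>f\<close> is a conditional of the state \<open>\<langle>f, id\<rangle> \<circ> p\<close> on its first factor.  The
  conditional has an extra input \<open>I\<close>, which is supplied by deletion.\<close>

lemma bayesian_inverse_exists:
  assumes "has_conditionals C" "f \<in> Arr C" "p \<in> Arr C" "Dom C p = Unit C" "Cod C p = Dom C f"
  shows "\<exists>b \<in> hom C (Cod C f) (Dom C f). \<langle>f, Id C (Dom C f)\<rangle> \<cdot> p = \<langle>Id C (Cod C f), b\<rangle> \<cdot> f \<cdot> p"
proof -
  let ?X = "Cod C f" and ?Y = "Dom C f" and ?I = "Unit C"
  let ?s = "\<langle>f, Id C ?Y\<rangle> \<cdot> p"
  define a where "a = f \<cdot> p"
  have a: "a \<in> Arr C" "Dom C a = ?I" "Cod C a = ?X"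
    using assms by (simp_all add: a_def)
  have "?s \<in> hom C ?I (?X \<boxtimes> ?Y)"
    using assms by (simp add: hom_def)
  moreover have "?I \<in> Obj C" "?X \<in> Obj C" "?Y \<in> Obj C" using assms by simp_all
  ultimately obtain c where "c \<in> hom C (?X \<boxtimes> ?I) ?Y" and
    s: "?s = (Id C ?X \<otimes> c) \<cdot> Assoc C ?X ?X ?I \<cdot> (Copy C ?X \<otimes> Id C ?I) \<cdot>
      ((proj1 C ?X ?Y \<cdot> ?s) \<otimes> Id C ?I) \<cdot> Copy C ?I"
    using assms(1) unfolding has_conditionals_def by blast
  then have c: "c \<in> Arr C" "Dom C c = ?X \<boxtimes> ?I" "Cod C c = ?Y" by (simp_all add: hom_def)
  have marg: "proj1 C ?X ?Y \<cdot> ?s = a"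
    using assms proj1_pairing[of f "Id C ?Y"] by (simp add: a_def comp_assoc[symmetric])
  define b where "b = c \<cdot> \<langle>Id C ?X, Del C ?X\<rangle>"
  have b: "b \<in> hom C ?X ?Y" using c assms by (simp add: b_def hom_def)
  \<comment> \<open>Both sides are the inverse right unitor after \<open>a\<close>.\<close>
  have insert_unit: "\<langle>a, Id C ?I\<rangle> = \<langle>Id C ?X, Del C ?X\<rangle> \<cdot> a"
  proof (rule runit_monic[of ?X])
    have "RUnit C ?X \<cdot> \<langle>a, Id C ?I\<rangle> = a"
      using runit_pairing_del[of a] a by (simp add: Del_Unit)
    moreover have "RUnit C ?X \<cdot> \<langle>Id C ?X, Del C ?X\<rangle> \<cdot> a = a"
      using runit_pairing_del[of "Id C ?X"] a assms by (simp add: comp_assoc[symmetric])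
    ultimately show "RUnit C ?X \<cdot> \<langle>a, Id C ?I\<rangle> = RUnit C ?X \<cdot> \<langle>Id C ?X, Del C ?X\<rangle> \<cdot> a" by simp
  qed (use a assms in simp_all)
  have "?s = (Id C ?X \<otimes> c) \<cdot> Assoc C ?X ?X ?I \<cdot> (Copy C ?X \<otimes> Id C ?I) \<cdot> \<langle>a, Id C ?I\<rangle>"
    using s a unfolding marg by (simp add: pairing_def)
  also have "\<dots> = (Id C ?X \<otimes> c) \<cdot> (Assoc C ?X ?X ?I \<cdot> \<langle>\<langle>Id C ?X, Id C ?X\<rangle>, Del C ?X\<rangle>) \<cdot> a"
    using a assms c by (simp add: insert_unit comp_assoc[symmetric] tensor_pairing pairing_id_id)
  also have "\<dots> = \<langle>Id C ?X, b\<rangle> \<cdot> a"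
    using a assms c assoc_pairing[of "Id C ?X" "Id C ?X" "Del C ?X"]
    by (simp add: comp_assoc[symmetric] tensor_pairing b_def)
  finally show ?thesis using b unfolding a_def by blast
qed

text \<open>If \<open>b\<close> is a Bayesian inverse of \<open>f\<close>, then \<open>\<langle>id, h f\<rangle> \<circ> p = \<langle>b, h\<rangle> \<circ> f \<circ> p\<close> for every \<open>h\<close>, and the right
  side depends on \<open>h\<close> only up to almost sure equality with respect to \<open>f \<circ> p\<close>.\<close>

lemma ae_eq_precomp:
  assumes "has_conditionals C" "f \<in> Arr C" "p \<in> Arr C" "Dom C p = Unit C" "Cod C p = Dom C f"
    and g: "ae_eq C (f \<cdot> p) g g'"
  shows "ae_eq C p (g \<cdot> f) (g' \<cdot> f)"
proof -
  let ?I = "Id C (Dom C f)"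
  note ae = ae_eqD[OF g]
  have dom: "Dom C g = Cod C f" using ae assms by simp
  obtain b where b: "b \<in> Arr C" "Dom C b = Cod C f" "Cod C b = Dom C f"
    and inv: "\<langle>f, ?I\<rangle> \<cdot> p = \<langle>Id C (Cod C f), b\<rangle> \<cdot> f \<cdot> p"
    using bayesian_inverse_exists[OF assms(1-5)] by (auto simp: hom_def)
  have fact: "\<langle>?I, h \<cdot> f\<rangle> \<cdot> p = \<langle>b, h\<rangle> \<cdot> f \<cdot> p" if h: "h \<in> Arr C" "Dom C h = Cod C f" for h
  proof -
    have "\<langle>?I, h \<cdot> f\<rangle> \<cdot> p = Swap C (Cod C h) (Dom C f) \<cdot> (h \<otimes> ?I) \<cdot> \<langle>f, ?I\<rangle> \<cdot> p"
      using h assms swap_pairing[of "h \<cdot> f" ?I] by (simp add: comp_assoc[symmetric] tensor_pairing)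
    also have "\<dots> = Swap C (Cod C h) (Cod C b) \<cdot> \<langle>h, b\<rangle> \<cdot> f \<cdot> p"
      unfolding inv using h b assms by (simp add: comp_assoc[symmetric] tensor_pairing)
    also have "\<dots> = \<langle>b, h\<rangle> \<cdot> f \<cdot> p"
      using h b assms swap_pairing[of h b] by (simp add: comp_assoc[symmetric])
    finally show ?thesis .
  qed
  have "\<langle>b, g\<rangle> \<cdot> f \<cdot> p = \<langle>b, g'\<rangle> \<cdot> f \<cdot> p"
    using ae_eq_pairing_right[OF g, of b] b dom by simp
  then show ?thesis
    using ae assms dom by (simp add: ae_eq_iff fact)
qed

lemma ae_deterministic_comp:
  assumes "has_conditionals C" "f \<in> Arr C" "p \<in> Arr C" "Dom C p = Unit C" "Cod C p = Dom C f"
    and f: "ae_deterministic C p f"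
    and g: "ae_deterministic C (f \<cdot> p) g" "g \<in> Arr C" "Dom C g = Cod C f"
  shows "ae_deterministic C p (g \<cdot> f)"
proof -
  have "ae_eq C p ((Copy C (Cod C g) \<cdot> g) \<cdot> f) (((g \<otimes> g) \<cdot> Copy C (Dom C g)) \<cdot> f)"
    using g by (intro ae_eq_precomp assms(1-5)) (simp add: ae_deterministic_def)
  then have "ae_eq C p (Copy C (Cod C g) \<cdot> g \<cdot> f) (\<langle>g, g\<rangle> \<cdot> f)"
    using g assms by (simp add: pairing_def comp_assoc)
  moreover have "ae_eq C p (\<langle>g, g\<rangle> \<cdot> f) \<langle>g \<cdot> f, g \<cdot> f\<rangle>"
    using f g assms by (intro ae_deterministic_pairing) simp_all
  ultimately have "ae_eq C p (Copy C (Cod C g) \<cdot> g \<cdot> f) \<langle>g \<cdot> f, g \<cdot> f\<rangle>" by (rule ae_eq_trans)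
  then show ?thesis
    using g assms by (simp add: ae_deterministic_def pairing_def)
qed

lemma ae_class_eqI: "ae_eq C p f g \<Longrightarrow> ae_class C p f = ae_class C p g"
  unfolding ae_class_def by (auto intro: ae_eq_trans ae_eq_sym)

lemma ae_class_eqD:
  assumes "ae_class C p f = ae_class C p g"
    and "f \<in> Arr C" "p \<in> Arr C" "Dom C p = Unit C" "Cod C p = Dom C f"
  shows "ae_eq C p f g"
  using assms ae_eq_refl[of f p] unfolding ae_class_def by blast

end

lemma sample_spaces_hom_iff:
  "F \<in> hom (sample_spaces C) (X, p) (Y, q) \<longleftrightarrow>
    (\<exists>f. F = ((X, p), ae_class C p f, (Y, q)) \<and> X \<in> Obj C \<and> Y \<in> Obj C \<and>
      p \<in> states C X \<and> f \<in> hom C X Y \<and> f \<cdot>\<^bsub>C\<^esub> p = q \<and> q \<in> states C Y \<and> ae_deterministic C p f)"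
proof -
  have "F \<in> hom (sample_spaces C) (X, p) (Y, q) \<longleftrightarrow>
    F \<in> prob_arrs C (ae_deterministic C) \<and> fst F = (X, p) \<and> snd (snd F) = (Y, q)"
    unfolding hom_def by (cases F) (simp add: sample_spaces_def prob_spaces_def)
  then show ?thesis
    unfolding prob_arrs_def mem_Collect_eq by (cases F) (simp, blast)
qed

lemma sample_spaces_simps [simp]:
  "Dom (sample_spaces C) (P, F, R) = P"
  "Cod (sample_spaces C) (P, F, R) = R"
  by (simp_all add: sample_spaces_def prob_spaces_def)

text \<open>Any two composites of representatives are almost surely equal, so the union of classes that
  defines composition is a single class.\<close>

lemma (in markov_category) sample_spaces_comp:
  assumes "has_conditionals C" "f \<in> Arr C" "p \<in> Arr C" "Dom C p = Unit C" "Cod C p = Dom C f"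
    and g: "g \<in> Arr C" "Dom C g = Cod C f" and q: "f \<cdot> p = q"
  shows "(Q, ae_class C q g, R) \<cdot>\<^bsub>sample_spaces C\<^esub> ((X, p), ae_class C p f, Q') =
    ((X, p), ae_class C p (g \<cdot> f), R)"
proof -
  have collapse: "ae_class C p (g' \<cdot> f') = ae_class C p (g \<cdot> f)"
    if f': "ae_eq C p f' f" and g': "ae_eq C q g' g" for f' g'
  proof (rule ae_class_eqI)
    note ae = ae_eqD[OF f'] ae_eqD[OF g']
    have "ae_eq C p (g' \<cdot> f') (g' \<cdot> f)"
      using f' ae g by (intro ae_eq_postcomp) simp_all
    moreover have "ae_eq C p (g' \<cdot> f) (g \<cdot> f)"
      using g' q by (intro ae_eq_precomp assms(1-5)) simp
    ultimately show "ae_eq C p (g' \<cdot> f') (g \<cdot> f)" by (rule ae_eq_trans)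
  qed
  have "ae_eq C p f f" "ae_eq C q g g"
    using assms by (auto intro!: ae_eq_refl)
  then have nonempty: "f \<in> ae_class C p f" "g \<in> ae_class C q g"
    by (simp_all add: ae_class_def)
  have "(\<Union>f' \<in> ae_class C p f. \<Union>g' \<in> ae_class C q g. ae_class C p (g' \<cdot> f')) =
      (\<Union>f' \<in> ae_class C p f. \<Union>g' \<in> ae_class C q g. ae_class C p (g \<cdot> f))"
    by (intro SUP_cong refl collapse) (simp_all add: ae_class_def)
  also have "\<dots> = ae_class C p (g \<cdot> f)"
    using nonempty by blast
  finally show ?thesis
    by (simp add: sample_spaces_def prob_spaces_def)
qed


lemma (in markov_category) sample_spaces_comp_in_hom:
  assumes "has_conditionals C" "F \<in> hom (sample_spaces C) P Q" "G \<in> hom (sample_spaces C) Q R"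
  shows "G \<cdot>\<^bsub>sample_spaces C\<^esub> F \<in> hom (sample_spaces C) P R"
proof -
  obtain X p Y q Z r where [simp]: "P = (X, p)" "Q = (Y, q)" "R = (Z, r)"
    by (cases P, cases Q, cases R)
  obtain f where F: "F = ((X, p), ae_class C p f, (Y, q))"
    and f: "f \<in> hom C X Y" "p \<in> states C X" "f \<cdot> p = q" "ae_deterministic C p f" "X \<in> Obj C"
    using assms(2) by (auto simp: sample_spaces_hom_iff)
  obtain g where G: "G = ((Y, q), ae_class C q g, (Z, r))"
    and g: "g \<in> hom C Y Z" "g \<cdot> q = r" "ae_deterministic C q g" "Z \<in> Obj C" "r \<in> states C Z"
    using assms(3) by (auto simp: sample_spaces_hom_iff)
  have arr: "f \<in> Arr C" "Dom C f = X" "Cod C f = Y" "g \<in> Arr C" "Dom C g = Y" "Cod C g = Z"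
    "p \<in> Arr C" "Dom C p = Unit C" "Cod C p = X"
    using f g by (simp_all add: hom_def states_def)
  have "G \<cdot>\<^bsub>sample_spaces C\<^esub> F = ((X, p), ae_class C p (g \<cdot> f), (Z, r))"
    unfolding F G using assms(1) arr f(3) by (intro sample_spaces_comp) simp_all
  moreover have "ae_deterministic C p (g \<cdot> f)"
    using assms(1) arr f g by (intro ae_deterministic_comp) simp_all
  moreover have "(g \<cdot> f) \<cdot> p = r" "g \<cdot> f \<in> hom C X Z"
    using arr f g by (simp_all add: comp_assoc hom_def)
  ultimately show ?thesis
    using f g by (auto simp: sample_spaces_hom_iff)
qed

section \<open>Pasting independent squares\<close>

context markov_category
begin

lemma tripling_ae_cong:
  assumes "ae_eq C p f f'" "ae_eq C p g g'" "ae_eq C p h h'"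
  shows "tripling C f g h \<cdot> p = tripling C f' g' h' \<cdot> p"
proof -
  have "Dom C g = Dom C f" "Dom C h = Dom C f" "Dom C f' = Dom C f" "Dom C g' = Dom C f" "Dom C h' = Dom C f"
    using assms[THEN ae_eqD(7)] assms[THEN ae_eqD(4)] by argo+
  note ae = this assms[THEN ae_eqD(1)] assms[THEN ae_eqD(2)]
  have "\<langle>f, \<langle>g, h\<rangle>\<rangle> \<cdot> p = \<langle>f', \<langle>g', h'\<rangle>\<rangle> \<cdot> p"
    by (intro ae_eq_comp_state ae_eq_pairing assms)
  then show ?thesis
    using ae by (simp add: tripling_eq_pairing)
qed

text \<open>By \<open>tripling_ae_cong\<close> the state \<open>\<langle>f, d, g\<rangle> \<circ> p\<close> is the same for all representatives, and the class of
  the diagonal is represented by \<open>u \<circ> f\<close>.\<close>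

lemma independent_square_iff_rep:
  assumes "has_conditionals C" "p \<in> states C \<Omega>" "f \<in> hom C \<Omega> X" "g \<in> hom C \<Omega> Y" "u \<in> hom C X Z"
    and x: "f \<cdot> p = x"
  shows "independent_square C ((\<Omega>, p), ae_class C p f, (X, x)) ((\<Omega>, p), ae_class C p g, (Y, y))
      ((X, x), ae_class C x u, (Z, z)) V \<longleftrightarrow>
    commutative_square (sample_spaces C) ((\<Omega>, p), ae_class C p f, (X, x)) ((\<Omega>, p), ae_class C p g, (Y, y))
      ((X, x), ae_class C x u, (Z, z)) V \<and>
    (\<exists>\<phi> \<in> hom C Z X. \<exists>\<psi> \<in> hom C Z Y.
      tripling C f (u \<cdot> f) g \<cdot> p = tripling C \<phi> (Id C Z) \<psi> \<cdot> z)"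
proof -
  have arr: "f \<in> Arr C" "Dom C f = \<Omega>" "Cod C f = X" "g \<in> Arr C" "Dom C g = \<Omega>" "u \<in> Arr C" "Dom C u = X"
    "p \<in> Arr C" "Dom C p = Unit C" "Cod C p = \<Omega>"
    using assms by (simp_all add: hom_def states_def)
  have d: "((X, x), ae_class C x u, (Z, z)) \<cdot>\<^bsub>sample_spaces C\<^esub> ((\<Omega>, p), ae_class C p f, (X, x)) =
      ((\<Omega>, p), ae_class C p (u \<cdot> f), (Z, z))"
    using assms(1) arr x by (intro sample_spaces_comp) simp_all
  have refl: "f \<in> ae_class C p f" "u \<cdot> f \<in> ae_class C p (u \<cdot> f)" "g \<in> ae_class C p g"
    using arr by (simp_all add: ae_class_def ae_eq_refl)
  have "tripling C f' d' g' \<cdot> p = tripling C f (u \<cdot> f) g \<cdot> p"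
    if "f' \<in> ae_class C p f" "d' \<in> ae_class C p (u \<cdot> f)" "g' \<in> ae_class C p g" for f' d' g'
    using that by (intro tripling_ae_cong) (simp_all add: ae_class_def)
  then have "(\<forall>f' \<in> ae_class C p f. \<forall>d' \<in> ae_class C p (u \<cdot> f). \<forall>g' \<in> ae_class C p g.
      tripling C f' d' g' \<cdot> p = s) \<longleftrightarrow> tripling C f (u \<cdot> f) g \<cdot> p = s" for s
    using refl by (metis (no_types))
  then show ?thesis
    by (simp add: independent_square_def d reps_def)
qed

text \<open>The mathematical core, in terms of representatives.  The map \<open>e\<close> stands for the diagonal of (B)
  and is an arbitrary map \<open>X\<^sub>1 \<rightarrow> Z\<close> here.\<close>

lemma independence_paste:
  assumes p: "p \<in> states C \<Omega>"
    and f1: "f1 \<in> hom C \<Omega> X1" "ae_deterministic C p f1" and f2: "f2 \<in> hom C \<Omega> X2"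
    and g1: "g1 \<in> hom C X1 Y2" and h1: "h1 \<in> hom C X1 Y1" and e: "e \<in> hom C X1 Z"
    and q: "q \<in> states C Y2" and \<phi>: "\<phi> \<in> hom C Y2 X1" and \<psi>: "\<psi> \<in> hom C Y2 X2"
    and A: "tripling C f1 (g1 \<cdot> f1) f2 \<cdot> p = tripling C \<phi> (Id C Y2) \<psi> \<cdot> q"
    and r: "r \<in> states C Z" and \<phi>': "\<phi>' \<in> hom C Z Y1" and \<psi>': "\<psi>' \<in> hom C Z Y2"
    and B: "tripling C h1 e g1 \<cdot> f1 \<cdot> p = tripling C \<phi>' (Id C Z) \<psi>' \<cdot> r"
  shows "tripling C (h1 \<cdot> f1) (e \<cdot> f1) f2 \<cdot> p = tripling C \<phi>' (Id C Z) (\<psi> \<cdot> \<psi>') \<cdot> r"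
proof -
  have arr: "p \<in> Arr C" "Dom C p = Unit C" "Cod C p = \<Omega>"
    "q \<in> Arr C" "Dom C q = Unit C" "Cod C q = Y2" "r \<in> Arr C" "Dom C r = Unit C" "Cod C r = Z"
    "f1 \<in> Arr C" "Dom C f1 = \<Omega>" "Cod C f1 = X1" "f2 \<in> Arr C" "Dom C f2 = \<Omega>" "Cod C f2 = X2"
    "g1 \<in> Arr C" "Dom C g1 = X1" "Cod C g1 = Y2" "h1 \<in> Arr C" "Dom C h1 = X1" "Cod C h1 = Y1"
    "e \<in> Arr C" "Dom C e = X1" "Cod C e = Z"
    "\<phi> \<in> Arr C" "Dom C \<phi> = Y2" "Cod C \<phi> = X1" "\<psi> \<in> Arr C" "Dom C \<psi> = Y2" "Cod C \<psi> = X2"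
    "\<phi>' \<in> Arr C" "Dom C \<phi>' = Z" "Cod C \<phi>' = Y1" "\<psi>' \<in> Arr C" "Dom C \<psi>' = Z" "Cod C \<psi>' = Y2"
    using assms by (simp_all add: hom_def states_def)
  have obj: "\<Omega> \<in> Obj C" "X1 \<in> Obj C" "X2 \<in> Obj C" "Y1 \<in> Obj C" "Y2 \<in> Obj C" "Z \<in> Obj C"
    using arr by (metis arr_simps(1,2))+
  let ?I = "Id C X1"
  have A': "\<langle>f1, \<langle>g1 \<cdot> f1, f2\<rangle>\<rangle> \<cdot> p = \<langle>\<phi>, \<langle>Id C Y2, \<psi>\<rangle>\<rangle> \<cdot> q"
    using A arr obj by (simp add: tripling_eq_pairing)
  have B': "\<langle>h1, \<langle>e, g1\<rangle>\<rangle> \<cdot> f1 \<cdot> p = \<langle>\<phi>', \<langle>Id C Z, \<psi>'\<rangle>\<rangle> \<cdot> r"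
    using B arr obj by (simp add: tripling_eq_pairing)

  \<comment> \<open>Two marginals of (A): forgetting \<open>f\<^sub>2\<close>, respectively the diagonal.\<close>
  have marg12: "\<langle>f1, g1 \<cdot> f1\<rangle> \<cdot> p = \<langle>\<phi>, Id C Y2\<rangle> \<cdot> q"
  proof -
    have "(?I \<otimes> proj1 C Y2 X2) \<cdot> \<langle>f1, \<langle>g1 \<cdot> f1, f2\<rangle>\<rangle> \<cdot> p =
        (?I \<otimes> proj1 C Y2 X2) \<cdot> \<langle>\<phi>, \<langle>Id C Y2, \<psi>\<rangle>\<rangle> \<cdot> q"
      unfolding A' ..
    then show ?thesis
      using arr obj proj1_pairing[of "g1 \<cdot> f1" f2] proj1_pairing[of "Id C Y2" \<psi>]
      by (simp add: comp_assoc[symmetric] tensor_pairing)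
  qed
  have marg13: "\<langle>f1, f2\<rangle> \<cdot> p = \<langle>\<phi>, \<psi>\<rangle> \<cdot> q"
  proof -
    have "(?I \<otimes> proj2 Y2 X2) \<cdot> \<langle>f1, \<langle>g1 \<cdot> f1, f2\<rangle>\<rangle> \<cdot> p =
        (?I \<otimes> proj2 Y2 X2) \<cdot> \<langle>\<phi>, \<langle>Id C Y2, \<psi>\<rangle>\<rangle> \<cdot> q"
      unfolding A' ..
    then show ?thesis
      using arr obj proj2_pairing[of "g1 \<cdot> f1" f2] proj2_pairing[of "Id C Y2" \<psi>]
      by (simp add: comp_assoc[symmetric] tensor_pairing)
  qed
  \<comment> \<open>The next two steps show that \<open>\<psi> \<circ> g\<^sub>1\<close> is a conditional distribution of \<open>f\<^sub>2\<close> given \<open>f\<^sub>1\<close>.\<close>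
  have graph_g1: "\<langle>?I, g1\<rangle> \<cdot> f1 \<cdot> p = \<langle>f1, g1 \<cdot> f1\<rangle> \<cdot> p"
    using ae_eq_comp_state[OF ae_deterministic_pairing[OF f1(2), of ?I g1]] arr obj
    by (simp add: comp_assoc)
  have kernel: "\<langle>?I, \<psi> \<cdot> g1\<rangle> \<cdot> f1 \<cdot> p = \<langle>f1, f2\<rangle> \<cdot> p"
  proof -
    have "\<langle>?I, \<psi> \<cdot> g1\<rangle> \<cdot> f1 \<cdot> p = (?I \<otimes> \<psi>) \<cdot> \<langle>?I, g1\<rangle> \<cdot> f1 \<cdot> p"
      using arr obj by (simp add: comp_assoc[symmetric] tensor_pairing)
    also have "\<dots> = (?I \<otimes> \<psi>) \<cdot> \<langle>\<phi>, Id C Y2\<rangle> \<cdot> q"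
      by (simp only: graph_g1 marg12)
    also have "\<dots> = \<langle>f1, f2\<rangle> \<cdot> p"
      using arr obj by (simp add: comp_assoc[symmetric] tensor_pairing marg13)
    finally show ?thesis .
  qed

  have det: "ae_eq C p (\<langle>h1, e\<rangle> \<cdot> f1) \<langle>h1 \<cdot> f1, e \<cdot> f1\<rangle>"
    using f1(2) arr by (intro ae_deterministic_pairing) simp_all
  let ?J = "Id C Y1 \<otimes> (Id C Z \<otimes> \<psi>)"
  have "\<langle>\<phi>', \<langle>Id C Z, \<psi> \<cdot> \<psi>'\<rangle>\<rangle> \<cdot> r = ?J \<cdot> \<langle>\<phi>', \<langle>Id C Z, \<psi>'\<rangle>\<rangle> \<cdot> r"
    using arr obj by (simp add: comp_assoc[symmetric] tensor_pairing)
  also have "\<dots> = ?J \<cdot> \<langle>h1, \<langle>e, g1\<rangle>\<rangle> \<cdot> f1 \<cdot> p"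
    unfolding B' ..
  also have "\<dots> = \<langle>h1, \<langle>e, \<psi> \<cdot> g1\<rangle>\<rangle> \<cdot> f1 \<cdot> p"
    using arr obj by (simp add: comp_assoc[symmetric] tensor_pairing)
  also have "\<dots> = Assoc C Y1 Z X2 \<cdot> (\<langle>h1, e\<rangle> \<otimes> Id C X2) \<cdot> \<langle>?I, \<psi> \<cdot> g1\<rangle> \<cdot> f1 \<cdot> p"
    using arr obj assoc_pairing[of h1 e "\<psi> \<cdot> g1"]
    by (simp add: comp_assoc[symmetric] tensor_pairing)
  also have "\<dots> = Assoc C Y1 Z X2 \<cdot> \<langle>\<langle>h1, e\<rangle> \<cdot> f1, f2\<rangle> \<cdot> p"
    unfolding kernel using arr obj by (simp add: comp_assoc[symmetric] tensor_pairing)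
  also have "\<langle>\<langle>h1, e\<rangle> \<cdot> f1, f2\<rangle> \<cdot> p = \<langle>\<langle>h1 \<cdot> f1, e \<cdot> f1\<rangle>, f2\<rangle> \<cdot> p"
    using det arr by (intro ae_eq_pairing_left) simp_all
  also have "Assoc C Y1 Z X2 \<cdot> \<dots> = \<langle>h1 \<cdot> f1, \<langle>e \<cdot> f1, f2\<rangle>\<rangle> \<cdot> p"
    using arr obj assoc_pairing[of "h1 \<cdot> f1" "e \<cdot> f1" f2] by (simp add: comp_assoc[symmetric])
  finally show ?thesis
    using arr obj by (simp add: tripling_eq_pairing)
qed

end

lemma commutative_square_iff:
  assumes "f \<in> hom D A X" "g \<in> hom D A Y" "u \<in> hom D X Z" "v \<in> hom D Y Z"
  shows "commutative_square D f g u v \<longleftrightarrow> u \<cdot>\<^bsub>D\<^esub> f = v \<cdot>\<^bsub>D\<^esub> g"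
  using assms by (auto simp: commutative_square_def hom_def)

lemma sample_spaces_hom_repE:
  assumes "F \<in> hom (sample_spaces C) (X, p) (Y, q)"
  obtains f where "F = ((X, p), ae_class C p f, (Y, q))" "f \<in> hom C X Y" "f \<cdot>\<^bsub>C\<^esub> p = q"
    "ae_deterministic C p f"
  using assms unfolding sample_spaces_hom_iff by blast

theorem proposition18:
  fixes C :: "('o, 'm, 'z) markov_cat_scheme"
  defines "S \<equiv> sample_spaces C"
  assumes "markov_category C" and "has_conditionals C"
    and "f1 \<in> hom S \<Omega> X1" and "f2 \<in> hom S \<Omega> X2"
    and "g1 \<in> hom S X1 Y2" and "g2 \<in> hom S X2 Y2"
    and "h1 \<in> hom S X1 Y1" and "k \<in> hom S Y1 Z" and "h2 \<in> hom S Y2 Z"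
    and "g1 \<cdot>\<^bsub>S\<^esub> f1 = g2 \<cdot>\<^bsub>S\<^esub> f2"
    and "k \<cdot>\<^bsub>S\<^esub> h1 = h2 \<cdot>\<^bsub>S\<^esub> g1"
    and "independent_square C f1 f2 g1 g2"
    and "independent_square C h1 g1 k h2"
  shows "independent_square C (h1 \<cdot>\<^bsub>S\<^esub> f1) f2 k (h2 \<cdot>\<^bsub>S\<^esub> g2)"
proof -
  interpret markov_category C by fact
  note cond = \<open>has_conditionals C\<close>
  note homs = assms(4-10)
  obtain o' p x1 p1 x2 p2 y1 q1 y2 q2 z r where
    [simp]: "\<Omega> = (o', p)" "X1 = (x1, p1)" "X2 = (x2, p2)" "Y1 = (y1, q1)" "Y2 = (y2, q2)" "Z = (z, r)"
    by (cases \<Omega>, cases X1, cases X2, cases Y1, cases Y2, cases Z)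
  obtain a1 where f1: "f1 = ((o', p), ae_class C p a1, (x1, p1))"
    and a1: "a1 \<in> hom C o' x1" "a1 \<cdot>\<^bsub>C\<^esub> p = p1" "ae_deterministic C p a1"
    using homs(1) by (auto simp: S_def elim: sample_spaces_hom_repE)
  obtain a2 where f2: "f2 = ((o', p), ae_class C p a2, (x2, p2))"
    and a2: "a2 \<in> hom C o' x2" "a2 \<cdot>\<^bsub>C\<^esub> p = p2"
    using homs(2) by (auto simp: S_def elim: sample_spaces_hom_repE)
  obtain b1 where g1: "g1 = ((x1, p1), ae_class C p1 b1, (y2, q2))"
    and b1: "b1 \<in> hom C x1 y2" "b1 \<cdot>\<^bsub>C\<^esub> p1 = q2"
    using homs(3) by (auto simp: S_def elim: sample_spaces_hom_repE)
  obtain b2 where g2: "g2 = ((x2, p2), ae_class C p2 b2, (y2, q2))"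
    and b2: "b2 \<in> hom C x2 y2" "b2 \<cdot>\<^bsub>C\<^esub> p2 = q2"
    using homs(4) by (auto simp: S_def elim: sample_spaces_hom_repE)
  obtain c1 where h1: "h1 = ((x1, p1), ae_class C p1 c1, (y1, q1))"
    and c1: "c1 \<in> hom C x1 y1" "c1 \<cdot>\<^bsub>C\<^esub> p1 = q1"
    using homs(5) by (auto simp: S_def elim: sample_spaces_hom_repE)
  obtain l where k: "k = ((y1, q1), ae_class C q1 l, (z, r))"
    and l: "l \<in> hom C y1 z" "l \<cdot>\<^bsub>C\<^esub> q1 = r"
    using homs(6) by (auto simp: S_def elim: sample_spaces_hom_repE)
  obtain c2 where h2: "h2 = ((y2, q2), ae_class C q2 c2, (z, r))"
    and c2: "c2 \<in> hom C y2 z" "c2 \<cdot>\<^bsub>C\<^esub> q2 = r"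
    using homs(7) by (auto simp: S_def elim: sample_spaces_hom_repE)
  have p: "p \<in> states C o'"
    using homs(1) by (auto simp: S_def sample_spaces_hom_iff)
  have arr: "p \<in> Arr C" "Dom C p = Unit C" "Cod C p = o'"
    "a1 \<in> Arr C" "Dom C a1 = o'" "Cod C a1 = x1" "a2 \<in> Arr C" "Dom C a2 = o'" "Cod C a2 = x2"
    "b1 \<in> Arr C" "Dom C b1 = x1" "Cod C b1 = y2" "b2 \<in> Arr C" "Dom C b2 = x2" "Cod C b2 = y2"
    "c1 \<in> Arr C" "Dom C c1 = x1" "Cod C c1 = y1" "c2 \<in> Arr C" "Dom C c2 = y2" "Cod C c2 = z"
    "l \<in> Arr C" "Dom C l = y1" "Cod C l = z"
    using p a1 a2 b1 b2 c1 c2 l by (simp_all add: hom_def states_def)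
  have p1: "p1 \<in> Arr C" "Dom C p1 = Unit C" "Cod C p1 = x1" "p1 \<in> states C x1"
    and p2: "p2 \<in> Arr C" "Dom C p2 = Unit C" "Cod C p2 = x2"
    and q1: "q1 \<in> Arr C" "Dom C q1 = Unit C" "Cod C q1 = y1"
    and q2: "q2 \<in> Arr C" "Dom C q2 = Unit C" "Cod C q2 = y2" "q2 \<in> states C y2"
    and r: "r \<in> states C z"
    using arr a1(2) a2(2) b1(2) c1(2) c2(2) by (auto simp: hom_def states_def)

  have h1f1: "h1 \<cdot>\<^bsub>S\<^esub> f1 = ((o', p), ae_class C p (c1 \<cdot>\<^bsub>C\<^esub> a1), (y1, q1))"
    unfolding h1 f1 S_def using cond arr a1 by (intro sample_spaces_comp) simp_all
  have h2g2: "h2 \<cdot>\<^bsub>S\<^esub> g2 = ((x2, p2), ae_class C p2 (c2 \<cdot>\<^bsub>C\<^esub> b2), (z, r))"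
    unfolding h2 g2 S_def using cond arr p2 b2 by (intro sample_spaces_comp) simp_all

  \<comment> \<open>The outer square commutes because the composites around (A) and (B) agree almost surely.\<close>
  have comm: "commutative_square S (h1 \<cdot>\<^bsub>S\<^esub> f1) f2 k (h2 \<cdot>\<^bsub>S\<^esub> g2)"
  proof -
    have "g1 \<cdot>\<^bsub>S\<^esub> f1 = ((o', p), ae_class C p (b1 \<cdot>\<^bsub>C\<^esub> a1), (y2, q2))"
      unfolding g1 f1 S_def using cond arr a1 by (intro sample_spaces_comp) simp_all
    moreover have "g2 \<cdot>\<^bsub>S\<^esub> f2 = ((o', p), ae_class C p (b2 \<cdot>\<^bsub>C\<^esub> a2), (y2, q2))"
      unfolding g2 f2 S_def using cond arr a2 by (intro sample_spaces_comp) simp_all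
    ultimately have A: "ae_eq C p (b1 \<cdot>\<^bsub>C\<^esub> a1) (b2 \<cdot>\<^bsub>C\<^esub> a2)"
      using assms(11) arr by (intro ae_class_eqD) simp_all
    have "k \<cdot>\<^bsub>S\<^esub> h1 = ((x1, p1), ae_class C p1 (l \<cdot>\<^bsub>C\<^esub> c1), (z, r))"
      unfolding k h1 S_def using cond arr p1 c1 by (intro sample_spaces_comp) simp_all
    moreover have "h2 \<cdot>\<^bsub>S\<^esub> g1 = ((x1, p1), ae_class C p1 (c2 \<cdot>\<^bsub>C\<^esub> b1), (z, r))"
      unfolding h2 g1 S_def using cond arr p1 b1 by (intro sample_spaces_comp) simp_all
    ultimately have B: "ae_eq C p1 (l \<cdot>\<^bsub>C\<^esub> c1) (c2 \<cdot>\<^bsub>C\<^esub> b1)"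
      using assms(12) arr p1 by (intro ae_class_eqD) simp_all
    have "ae_eq C p ((l \<cdot>\<^bsub>C\<^esub> c1) \<cdot>\<^bsub>C\<^esub> a1) ((c2 \<cdot>\<^bsub>C\<^esub> b1) \<cdot>\<^bsub>C\<^esub> a1)"
      using cond arr a1 B by (intro ae_eq_precomp) simp_all
    moreover have "ae_eq C p (c2 \<cdot>\<^bsub>C\<^esub> b1 \<cdot>\<^bsub>C\<^esub> a1) (c2 \<cdot>\<^bsub>C\<^esub> b2 \<cdot>\<^bsub>C\<^esub> a2)"
      using arr A by (intro ae_eq_postcomp) simp_all
    ultimately have "ae_eq C p (l \<cdot>\<^bsub>C\<^esub> c1 \<cdot>\<^bsub>C\<^esub> a1) ((c2 \<cdot>\<^bsub>C\<^esub> b2) \<cdot>\<^bsub>C\<^esub> a2)"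
      using arr by (auto simp: comp_assoc intro: ae_eq_trans)
    then have eq: "ae_class C p (l \<cdot>\<^bsub>C\<^esub> c1 \<cdot>\<^bsub>C\<^esub> a1) = ae_class C p ((c2 \<cdot>\<^bsub>C\<^esub> b2) \<cdot>\<^bsub>C\<^esub> a2)"
      by (rule ae_class_eqI)
    have "k \<cdot>\<^bsub>S\<^esub> (h1 \<cdot>\<^bsub>S\<^esub> f1) = ((o', p), ae_class C p (l \<cdot>\<^bsub>C\<^esub> c1 \<cdot>\<^bsub>C\<^esub> a1), (z, r))"
      unfolding h1f1 unfolding k S_def using cond arr a1 c1
      by (intro sample_spaces_comp) (simp_all add: comp_assoc)
    moreover have "(h2 \<cdot>\<^bsub>S\<^esub> g2) \<cdot>\<^bsub>S\<^esub> f2 = ((o', p), ae_class C p ((c2 \<cdot>\<^bsub>C\<^esub> b2) \<cdot>\<^bsub>C\<^esub> a2), (z, r))"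
      unfolding h2g2 unfolding f2 S_def using cond arr a2 by (intro sample_spaces_comp) simp_all
    moreover have "h1 \<cdot>\<^bsub>S\<^esub> f1 \<in> hom S \<Omega> Y1" "h2 \<cdot>\<^bsub>S\<^esub> g2 \<in> hom S X2 Z"
      using homs unfolding S_def by (blast intro: sample_spaces_comp_in_hom[OF cond])+
    ultimately show ?thesis
      using homs eq by (simp add: commutative_square_iff)
  qed

  obtain \<phi> \<psi> where A: "\<phi> \<in> hom C y2 x1" "\<psi> \<in> hom C y2 x2"
    "tripling C a1 (b1 \<cdot>\<^bsub>C\<^esub> a1) a2 \<cdot>\<^bsub>C\<^esub> p = tripling C \<phi> (Id C y2) \<psi> \<cdot>\<^bsub>C\<^esub> q2"
    using assms(13) independent_square_iff_rep[OF cond p a1(1) a2(1) b1(1) a1(2)]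
    unfolding f1 f2 g1 by blast
  obtain \<phi>' \<psi>' where B: "\<phi>' \<in> hom C z y1" "\<psi>' \<in> hom C z y2"
    "tripling C c1 (l \<cdot>\<^bsub>C\<^esub> c1) b1 \<cdot>\<^bsub>C\<^esub> p1 = tripling C \<phi>' (Id C z) \<psi>' \<cdot>\<^bsub>C\<^esub> r"
    using assms(14) independent_square_iff_rep[OF cond p1(4) c1(1) b1(1) l(1) c1(2)]
    unfolding h1 g1 k by blast
  have lc1: "l \<cdot>\<^bsub>C\<^esub> c1 \<in> hom C x1 z" using arr by (simp add: hom_def)
  have "tripling C (c1 \<cdot>\<^bsub>C\<^esub> a1) ((l \<cdot>\<^bsub>C\<^esub> c1) \<cdot>\<^bsub>C\<^esub> a1) a2 \<cdot>\<^bsub>C\<^esub> p = tripling C \<phi>' (Id C z) (\<psi> \<cdot>\<^bsub>C\<^esub> \<psi>') \<cdot>\<^bsub>C\<^esub> r"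
    using B(3) a1(2)
    by (intro independence_paste[OF p a1(1,3) a2(1) b1(1) c1(1) lc1 q2(4) A r B(1,2)]) simp
  then have "tripling C (c1 \<cdot>\<^bsub>C\<^esub> a1) (l \<cdot>\<^bsub>C\<^esub> c1 \<cdot>\<^bsub>C\<^esub> a1) a2 \<cdot>\<^bsub>C\<^esub> p = tripling C \<phi>' (Id C z) (\<psi> \<cdot>\<^bsub>C\<^esub> \<psi>') \<cdot>\<^bsub>C\<^esub> r"
    using arr by (simp add: comp_assoc)
  moreover have "\<psi> \<cdot>\<^bsub>C\<^esub> \<psi>' \<in> hom C z x2" using A(2) B(2) by (blast intro: Comp_in_hom)
  moreover have "c1 \<cdot>\<^bsub>C\<^esub> a1 \<in> hom C o' y1" "(c1 \<cdot>\<^bsub>C\<^esub> a1) \<cdot>\<^bsub>C\<^esub> p = q1"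
    using arr a1(2) c1(2) by (simp_all add: hom_def comp_assoc)
  ultimately show ?thesis
    using comm B(1) independent_square_iff_rep[OF cond p _ a2(1) l(1), of "c1 \<cdot>\<^bsub>C\<^esub> a1" q1]
    unfolding h1f1 unfolding f2 k S_def by blast
qed

end
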